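(* Let $q\in C[0,b]$ be complex valued and let $f$ be a solution of $f''=qf$ on $[0,b]$ with $f(0)=1$ and $f\neq0$ on $[0,b]$. Let $\mathbf{C}_N=\sum_{n=0}^N\alpha_n\frac{\mathbf{c}_n}{n!}$ with complex numbers $\alpha_0,\ldots,\alpha_N$ (a $\mathbf{c}$-polynomial of order $N$). Then its coefficients are uniquely determined by the relations $\alpha_0=\mathbf{C}_N(0)$ and $$\alpha_{j+1}=\gamma_1(\gamma_2\gamma_1)^j\mathbf{C}_N(0)+\sum_{\text{even }n=2}^{j}\alpha_n\,\gamma_1(\gamma_2\gamma_1)^{j-n}[1](0),\qquad j=0,1,2,\ldots,N-1.$$
   Context: Generalized derivatives: $\gamma_1g(x)=f^2(x)\frac{d}{dx}\left(\frac{g(x)}{f(x)}\right)$, $\gamma_2g(x)=\frac12\int_0^x\frac{g'(s)}{f(s)}ds$. The operator $\gamma_2\gamma_1$ is understood in the extended sense $\gamma_2\gamma_1g(x)=\frac12\left(g'(x)-g'(0)-\int_0^x q(s)g(s)\,ds\right)$ on $C^1[0,b]$ (which agrees with the composition for $g\in C^2[0,b]$). $(\gamma_2\gamma_1)^0$ is the identity and $(\gamma_2\gamma_1)^j$ is the $j$-fold iterate; $(\gamma_2\gamma_1)^j[1]$ is its action on the constant function $1$. Empty sums are $0$. Standing regularity convention: whenever a function $(\gamma_2\gamma_1)^i[1]$ occurs, $q$ is assumed regular enough for it to be well defined ($q\in W_2^{i-1}[0,b]$ for $i\ge1$), and for $\gamma_1(\gamma_2\gamma_1)^i[1](0)$ to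 exist. Functions $\varphi_k$: $X^{(0)}\equiv\widetilde X^{(0)}\equiv1$, $X^{(n)}(x)=n\int_0^x X^{(n-1)}(s)\left(f^2(s)\right)^{(-1)^n}ds$, $\widetilde X^{(n)}(x)=n\int_0^x \widetilde X^{(n-1)}(s)\left(f^2(s)\right)^{(-1)^{n-1}}ds$ for $n\ge1$; $\varphi_k=fX^{(k)}$ for $k$ odd, $\varphi_k=f\widetilde X^{(k)}$ for $k$ even. Then $\mathbf{c}_0=f$ and $\mathbf{c}_m(x)=\sum_{\text{even }k=0}^m\binom mk x^k\varphi_{m-k}(x)$ for $m\ge1$. *)

theory Defs
  imports "HOL-Analysis.Analysis"
begin

text \<open>Functions on \<open>[0,b]\<close> are represented by total functions \<open>real \<Rightarrow> complex\<close>; all derivatives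
  are taken within \<open>{0..b}\<close> (hence one-sided at the end points), so that only the values on
  \<open>{0..b}\<close> matter.\<close>

definition C1_on :: "real \<Rightarrow> (real \<Rightarrow> complex) \<Rightarrow> bool" where
  "C1_on b g \<longleftrightarrow> (\<exists>g'. continuous_on {0..b} g' \<and>
     (\<forall>x\<in>{0..b}. (g has_vector_derivative g' x) (at x within {0..b})))"

text \<open>The Sobolev space $W_2^k[0,b]$, identified with the (absolutely continuous, if \<open>k \<ge> 1\<close>)
  representatives of its elements.\<close>

fun sobolev_W2 :: "real \<Rightarrow> nat \<Rightarrow> (real \<Rightarrow> complex) \<Rightarrow> bool" where
  "sobolev_W2 b 0 h \<longleftrightarrow> h \<in> borel_measurable (lebesgue_on {0..b}) \<and>
     integrable (lebesgue_on {0..b}) (\<lambda>x. (norm (h x))\<^sup>2)"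
| "sobolev_W2 b (Suc k) h \<longleftrightarrow>
     (\<exists>g. sobolev_W2 b k g \<and> (\<forall>x\<in>{0..b}. (g has_integral (h x - h 0)) {0..x}))"

definition solves_schroedinger :: "real \<Rightarrow> (real \<Rightarrow> complex) \<Rightarrow> (real \<Rightarrow> complex) \<Rightarrow> bool" where
  "solves_schroedinger b q f \<longleftrightarrow> (\<exists>f'. \<forall>x\<in>{0..b}.
     (f has_vector_derivative f' x) (at x within {0..b}) \<and>
     (f' has_vector_derivative q x * f x) (at x within {0..b}))"

definition gamma1 :: "real \<Rightarrow> (real \<Rightarrow> complex) \<Rightarrow> (real \<Rightarrow> complex) \<Rightarrow> real \<Rightarrow> complex" where
  "gamma1 b f g x = (f x)\<^sup>2 * vector_derivative (\<lambda>s. g s / f s) (at x within {0..b})"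

definition gamma1_exists_at ::
    "real \<Rightarrow> (real \<Rightarrow> complex) \<Rightarrow> (real \<Rightarrow> complex) \<Rightarrow> real \<Rightarrow> bool" where
  "gamma1_exists_at b f g x \<longleftrightarrow> (\<lambda>s. g s / f s) differentiable (at x within {0..b})"

text \<open>The operator $\gamma_2\gamma_1$ in the extended sense, meaningful on $C^1[0,b]$.  It does not
  involve \<open>f\<close>: for $g \in C^2[0,b]$, $(\gamma_1 g)'/f = (f g'' - f'' g)/f = g'' - q g$.\<close>

definition gamma21 :: "real \<Rightarrow> (real \<Rightarrow> complex) \<Rightarrow> (real \<Rightarrow> complex) \<Rightarrow> real \<Rightarrow> complex" where
  "gamma21 b q g x = (1/2) *
     (vector_derivative g (at x within {0..b}) - vector_derivative g (at 0 within {0..b})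
      - integral {0..x} (\<lambda>s. q s * g s))"

definition gamma21_pow ::
    "real \<Rightarrow> (real \<Rightarrow> complex) \<Rightarrow> nat \<Rightarrow> (real \<Rightarrow> complex) \<Rightarrow> real \<Rightarrow> complex" where
  "gamma21_pow b q j g = (gamma21 b q ^^ j) g"

text \<open>$(\gamma_2\gamma_1)^j g$ is well defined if each application acts on a $C^1$ function.\<close>

definition gamma21_pow_defined ::
    "real \<Rightarrow> (real \<Rightarrow> complex) \<Rightarrow> nat \<Rightarrow> (real \<Rightarrow> complex) \<Rightarrow> bool" where
  "gamma21_pow_defined b q j g \<longleftrightarrow> (\<forall>i<j. C1_on b (gamma21_pow b q i g))"

text \<open>The standing regularity assumption on \<open>q\<close> attached to an occurrence of
  $\gamma_1(\gamma_2\gamma_1)^i[1](0)$.\<close>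

definition regular_for ::
    "real \<Rightarrow> (real \<Rightarrow> complex) \<Rightarrow> (real \<Rightarrow> complex) \<Rightarrow> nat \<Rightarrow> bool" where
  "regular_for b q f i \<longleftrightarrow> (i \<ge> 1 \<longrightarrow> sobolev_W2 b (i - 1) q) \<and>
     gamma1_exists_at b f (gamma21_pow b q i (\<lambda>_. 1)) 0"

primrec X_fun :: "(real \<Rightarrow> complex) \<Rightarrow> nat \<Rightarrow> real \<Rightarrow> complex" where
  "X_fun f 0 = (\<lambda>x. 1)"
| "X_fun f (Suc n) = (\<lambda>x. of_nat (Suc n) *
     integral {0..x} (\<lambda>s. X_fun f n s * ((f s)\<^sup>2) powi ((- 1) ^ Suc n)))"

primrec X_tilde :: "(real \<Rightarrow> complex) \<Rightarrow> nat \<Rightarrow> real \<Rightarrow> complex" where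
  "X_tilde f 0 = (\<lambda>x. 1)"
| "X_tilde f (Suc n) = (\<lambda>x. of_nat (Suc n) *
     integral {0..x} (\<lambda>s. X_tilde f n s * ((f s)\<^sup>2) powi ((- 1) ^ n)))"

definition phi :: "(real \<Rightarrow> complex) \<Rightarrow> nat \<Rightarrow> real \<Rightarrow> complex" where
  "phi f k x = f x * (if odd k then X_fun f k x else X_tilde f k x)"

definition c_fun :: "(real \<Rightarrow> complex) \<Rightarrow> nat \<Rightarrow> real \<Rightarrow> complex" where
  "c_fun f m x = (\<Sum>k | k \<le> m \<and> even k. of_nat (m choose k) * of_real x ^ k * phi f (m - k) x)"

lemma c_fun_0: "c_fun f 0 = f"
proof -
  have "{k::nat. k = 0 \<and> even k} = {0}" by auto
  then show ?thesis by (auto simp: c_fun_def phi_def fun_eq_iff)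
qed

definition c_poly :: "(real \<Rightarrow> complex) \<Rightarrow> nat \<Rightarrow> (nat \<Rightarrow> complex) \<Rightarrow> real \<Rightarrow> complex" where
  "c_poly f N \<alpha> x = (\<Sum>n\<le>N. \<alpha> n * (c_fun f n x / fact n))"

definition coeff_relations ::
    "real \<Rightarrow> (real \<Rightarrow> complex) \<Rightarrow> (real \<Rightarrow> complex) \<Rightarrow> (real \<Rightarrow> complex) \<Rightarrow> nat \<Rightarrow> (nat \<Rightarrow> complex) \<Rightarrow> bool"
  where
  "coeff_relations b q f C N \<alpha> \<longleftrightarrow> \<alpha> 0 = C 0 \<and>
     (\<forall>j<N. \<alpha> (j + 1) = gamma1 b f (gamma21_pow b q j C) 0 +
        (\<Sum>n | 2 \<le> n \<and> n \<le> j \<and> even n.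
           \<alpha> n * gamma1 b f (gamma21_pow b q (j - n) (\<lambda>_. 1)) 0))"

end

theory Submission
  imports Defs
begin

text \<open>Write \<open>A\<close> for \<open>\<gamma>\<^sub>2\<gamma>\<^sub>1\<close> in its extended sense, so that \<open>2 A g\<close> is the increment from \<open>0\<close> of
  \<open>g' - \<integral> q g\<close>.  Up to the factor \<open>2\<close> and one integration, \<open>A\<close> is the Schroedinger operator, and the
  functions \<open>c\<^sub>n / n!\<close> play for it the part of the monomials in Taylor's formula.

  The normalized functions \<open>\<psi>\<^sub>k = \<phi>\<^sub>k / k!\<close> satisfy \<open>\<psi>\<^sub>k'' = q \<psi>\<^sub>k + \<psi>\<^sub>k\<^sub>-\<^sub>2\<close>.  Let \<open>T\<^sub>m\<close> be the sum of
  \<open>(x\<^sup>k / k!) \<psi>\<^sub>m\<^sub>-\<^sub>k\<close> over the even \<open>k \<le> m\<close>, which is \<open>c\<^sub>m / m!\<close>, and \<open>S\<^sub>m\<close> the sum of the same terms over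
  the odd \<open>k\<close>.  Differentiating \<open>x\<^sup>k / k!\<close> lowers \<open>m\<close> by one and exchanges the parities, so the
  product rule gives \<open>T\<^sub>m'' - q T\<^sub>m = 2 S\<^sub>m\<^sub>-\<^sub>1'\<close> and \<open>S\<^sub>m'' - q S\<^sub>m = 2 T\<^sub>m\<^sub>-\<^sub>1'\<close>.  Integrating,
  \<open>A T\<^sub>m = S\<^sub>m\<^sub>-\<^sub>1\<close> and \<open>A S\<^sub>m = T\<^sub>m\<^sub>-\<^sub>1 - T\<^sub>m\<^sub>-\<^sub>1(0)\<close>; the last constant is \<open>1\<close> for \<open>m = 1\<close> and \<open>0\<close>
  otherwise (lemma \<open>gamma21_parity_c\<close>).

  Hence each application of \<open>A\<close> lowers every index by one, a function of index \<open>0\<close> is annihilated,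
  and \<open>c\<^sub>n / n!\<close> with \<open>n \<ge> 2\<close> even ejects the constant \<open>-1\<close> at the \<open>n\<close>-th step, on which the later
  applications of \<open>A\<close> go on acting.  So \<open>A\<^sup>j\<close> of a \<open>c\<close>-polynomial is a combination
  of \<open>T\<^sub>0, T\<^sub>1, \<dots>\<close> or of \<open>S\<^sub>0, S\<^sub>1, \<dots>\<close> with coefficients \<open>\<alpha>\<^sub>j, \<alpha>\<^sub>j\<^sub>+\<^sub>1, \<dots>\<close>, minus the sum of
  \<open>\<alpha>\<^sub>n A\<^sup>j\<^sup>-\<^sup>n[1]\<close> over the even \<open>n\<close> between \<open>2\<close> and \<open>j\<close> (lemma \<open>gamma21_pow_c_poly\<close>).  At \<open>0\<close>, the
  operator \<open>\<gamma>\<^sub>1\<close> gives \<open>1\<close> on \<open>T\<^sub>1\<close> and \<open>S\<^sub>1\<close> and \<open>0\<close> on all other indices, so it picks out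
  \<open>\<alpha>\<^sub>j\<^sub>+\<^sub>1\<close>.  This is the stated relation.

  All of this needs the ejected constants to stay in \<open>C\<^sup>1\<close> along the iteration: \<open>A\<close> costs one
  derivative, while \<open>A[1]\<close> is one derivative smoother than \<open>q\<close>, and \<open>W\<^sub>2\<^sup>k\<^sup>+\<^sup>1 \<subseteq> C\<^sup>k\<close>
  (lemma \<open>C1_on_gamma21_pow_one\<close>).  Uniqueness is then formal: the relations are recursive in \<open>j\<close>, and
  any other coefficients of the same function satisfy them too.\<close>

section \<open>Derivatives on the interval\<close>

definition deriv_on :: "real \<Rightarrow> (real \<Rightarrow> complex) \<Rightarrow> (real \<Rightarrow> complex) \<Rightarrow> bool" where
  "deriv_on b g g' \<longleftrightarrow> (\<forall>x\<in>{0..b}. (g has_vector_derivative g' x) (at x within {0..b}))"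

lemma deriv_onD:
  "deriv_on b g g' \<Longrightarrow> x \<in> {0..b} \<Longrightarrow> (g has_vector_derivative g' x) (at x within {0..b})"
  by (simp add: deriv_on_def)

lemma deriv_on_continuous: "deriv_on b g g' \<Longrightarrow> continuous_on {0..b} g"
  unfolding deriv_on_def continuous_on_eq_continuous_within
  using has_vector_derivative_continuous by blast

lemma deriv_on_const: "deriv_on b (\<lambda>_. c) (\<lambda>_. 0)"
  by (simp add: deriv_on_def)

lemma deriv_on_add:
  "deriv_on b g g' \<Longrightarrow> deriv_on b h h' \<Longrightarrow> deriv_on b (\<lambda>x. g x + h x) (\<lambda>x. g' x + h' x)"
  unfolding deriv_on_def by (blast intro: has_vector_derivative_add)

lemma deriv_on_diff:
  "deriv_on b g g' \<Longrightarrow> deriv_on b h h' \<Longrightarrow> deriv_on b (\<lambda>x. g x - h x) (\<lambda>x. g' x - h' x)"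
  unfolding deriv_on_def by (blast intro: has_vector_derivative_diff)

lemma deriv_on_mult:
  "deriv_on b g g' \<Longrightarrow> deriv_on b h h' \<Longrightarrow>
    deriv_on b (\<lambda>x. g x * h x) (\<lambda>x. g x * h' x + g' x * h x)"
  unfolding deriv_on_def by (blast intro: has_vector_derivative_mult)

lemma deriv_on_cmult: "deriv_on b g g' \<Longrightarrow> deriv_on b (\<lambda>x. c * g x) (\<lambda>x. c * g' x)"
  using deriv_on_mult[OF deriv_on_const[of b c], of g g'] by simp

lemma deriv_on_sum:
  "(\<And>i. i \<in> I \<Longrightarrow> deriv_on b (g i) (g' i)) \<Longrightarrow>
    deriv_on b (\<lambda>x. \<Sum>i\<in>I. g i x) (\<lambda>x. \<Sum>i\<in>I. g' i x)"
  unfolding deriv_on_def by (auto intro: has_vector_derivative_sum)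

lemma deriv_on_cong:
  assumes "deriv_on b g g'" "\<And>x. x \<in> {0..b} \<Longrightarrow> h x = g x" "\<And>x. x \<in> {0..b} \<Longrightarrow> h' x = g' x"
  shows "deriv_on b h h'"
  unfolding deriv_on_def
proof
  fix x assume x: "x \<in> {0..b}"
  show "(h has_vector_derivative h' x) (at x within {0..b})"
    using has_vector_derivative_transform[OF x assms(2) deriv_onD[OF assms(1) x]] assms(3)[OF x]
    by simp
qed

lemma deriv_on_inverse:
  assumes g: "deriv_on b g g'" and nz: "\<And>x. x \<in> {0..b} \<Longrightarrow> g x \<noteq> 0"
  shows "deriv_on b (\<lambda>x. inverse (g x)) (\<lambda>x. - (g' x / (g x)\<^sup>2))"
  unfolding deriv_on_def
proof
  fix x assume x: "x \<in> {0..b}"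
  have "(inverse has_field_derivative - (inverse (g x) ^ Suc (Suc 0))) (at (g x) within g ` {0..b})"
    using DERIV_inverse[OF nz[OF x]] by (rule has_field_derivative_at_within)
  from field_vector_diff_chain_within[OF deriv_onD[OF g x] this]
  show "((\<lambda>x. inverse (g x)) has_vector_derivative - (g' x / (g x)\<^sup>2)) (at x within {0..b})"
    by (simp add: o_def field_simps power2_eq_square)
qed

lemma deriv_on_integral:
  "continuous_on {0..b} g \<Longrightarrow> deriv_on b (\<lambda>x. integral {0..x} g) g"
  unfolding deriv_on_def by (blast intro: integral_has_vector_derivative)

lemma deriv_on_has_integral:
  assumes "deriv_on b g g'" "x \<in> {0..b}"
  shows "(g' has_integral (g x - g 0)) {0..x}"
proof (rule fundamental_theorem_of_calculus)
  show "0 \<le> x" using assms(2) by simp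
  fix y assume "y \<in> {0..x}"
  then have "y \<in> {0..b}" "{0..x} \<subseteq> {0..b}" using assms(2) by auto
  then show "(g has_vector_derivative g' y) (at y within {0..x})"
    using deriv_onD[OF assms(1)] has_vector_derivative_within_subset by blast
qed

lemma deriv_on_vector_derivative:
  assumes "0 < b" "deriv_on b g g'" "x \<in> {0..b}"
  shows "vector_derivative g (at x within {0..b}) = g' x"
  using vector_derivative_within_closed_interval[OF assms(1,3) deriv_onD[OF assms(2,3)]] .

text \<open>Nested existential derivatives make products and antiderivatives amenable to induction on the
  order; order one is \<^const>\<open>C1_on\<close>.\<close>

primrec Ck_on :: "real \<Rightarrow> nat \<Rightarrow> (real \<Rightarrow> complex) \<Rightarrow> bool" where
  "Ck_on b 0 g \<longleftrightarrow> continuous_on {0..b} g"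
| "Ck_on b (Suc k) g \<longleftrightarrow> (\<exists>g'. Ck_on b k g' \<and> deriv_on b g g')"

lemma C1_on_iff: "C1_on b g \<longleftrightarrow> Ck_on b (Suc 0) g"
  by (simp add: C1_on_def deriv_on_def)

lemma Ck_on_Suc_imp: "Ck_on b (Suc k) g \<Longrightarrow> Ck_on b k g"
proof (induction k arbitrary: g)
  case 0
  then show ?case using deriv_on_continuous by auto
next
  case (Suc k)
  then obtain g' where "Ck_on b (Suc k) g'" "deriv_on b g g'" using Ck_on.simps(2) by blast
  with Suc.IH show ?case by auto
qed

lemma Ck_on_mono: "Ck_on b n g \<Longrightarrow> k \<le> n \<Longrightarrow> Ck_on b k g"
  by (induction n) (auto simp: le_Suc_eq dest: Ck_on_Suc_imp simp del: Ck_on.simps)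

lemma Ck_on_const: "Ck_on b k (\<lambda>_. c)"
proof (induction k arbitrary: c)
  case 0
  show ?case by simp
next
  case (Suc k)
  from Suc.IH[of 0] deriv_on_const[of b c] show ?case by auto
qed

lemma Ck_on_add: "Ck_on b k g \<Longrightarrow> Ck_on b k h \<Longrightarrow> Ck_on b k (\<lambda>x. g x + h x)"
proof (induction k arbitrary: g h)
  case 0
  then show ?case by (simp add: continuous_on_add)
next
  case (Suc k)
  then obtain g' h' where *: "Ck_on b k g'" "deriv_on b g g'" "Ck_on b k h'" "deriv_on b h h'"
    by auto
  from Suc.IH[OF *(1,3)] deriv_on_add[OF *(2,4)] show ?case by auto
qed

lemma Ck_on_mult: "Ck_on b k g \<Longrightarrow> Ck_on b k h \<Longrightarrow> Ck_on b k (\<lambda>x. g x * h x)"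
proof (induction k arbitrary: g h)
  case 0
  then show ?case by (simp add: continuous_on_mult)
next
  case (Suc k)
  then obtain g' h' where *: "Ck_on b k g'" "deriv_on b g g'" "Ck_on b k h'" "deriv_on b h h'"
    by auto
  have "Ck_on b k (\<lambda>x. g x * h' x + g' x * h x)"
    by (intro Ck_on_add Suc.IH * Ck_on_Suc_imp[OF Suc.prems(1)] Ck_on_Suc_imp[OF Suc.prems(2)])
  with deriv_on_mult[OF *(2,4)] show ?case by auto
qed

lemma Ck_on_cong: "Ck_on b k g \<Longrightarrow> (\<And>x. x \<in> {0..b} \<Longrightarrow> h x = g x) \<Longrightarrow> Ck_on b k h"
proof (cases k)
  case 0
  assume "Ck_on b k g" "\<And>x. x \<in> {0..b} \<Longrightarrow> h x = g x"
  with 0 show ?thesis using continuous_on_cong[OF refl, of "{0..b}" h g] by simp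
next
  case (Suc n)
  assume *: "Ck_on b k g" "\<And>x. x \<in> {0..b} \<Longrightarrow> h x = g x"
  with Suc obtain g' where "Ck_on b n g'" "deriv_on b g g'" by auto
  moreover from this(2) have "deriv_on b h g'" by (rule deriv_on_cong) (use *(2) in auto)
  ultimately show ?thesis using Suc by auto
qed

lemma C1_on_imp_deriv_on: "C1_on b g \<Longrightarrow> \<exists>g'. deriv_on b g g'"
  by (auto simp: C1_on_iff)

lemma C1_on_if_deriv_on: "deriv_on b g g' \<Longrightarrow> deriv_on b g' g'' \<Longrightarrow> C1_on b g"
  using deriv_on_continuous by (auto simp: C1_on_iff)

lemma C1_on_cong: "C1_on b g \<Longrightarrow> (\<And>x. x \<in> {0..b} \<Longrightarrow> h x = g x) \<Longrightarrow> C1_on b h"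
  unfolding C1_on_iff by (rule Ck_on_cong)

lemma C1_on_cmult: "C1_on b g \<Longrightarrow> C1_on b (\<lambda>x. c * g x)"
  unfolding C1_on_iff by (rule Ck_on_mult[OF Ck_on_const])

lemma C1_on_diff: "C1_on b g \<Longrightarrow> C1_on b h \<Longrightarrow> C1_on b (\<lambda>x. g x - h x)"
  using Ck_on_add[of b "Suc 0" g "\<lambda>x. (-1) * h x"] C1_on_cmult[of b h "-1"]
  unfolding C1_on_iff by simp

lemma C1_on_sum:
  "finite I \<Longrightarrow> (\<And>i. i \<in> I \<Longrightarrow> C1_on b (g i)) \<Longrightarrow> C1_on b (\<lambda>x. \<Sum>i\<in>I. g i x)"
  unfolding C1_on_iff
  by (induction I rule: finite_induct) (simp_all add: Ck_on_const Ck_on_add del: Ck_on.simps)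

text \<open>Each \<open>h\<close> of order \<open>k + 1\<close> is an antiderivative of some \<open>g\<close> of order \<open>k\<close>.  If \<open>g\<close> is merely
  integrable, this makes \<open>h\<close> continuous; if \<open>g\<close> is already continuous, it makes \<open>g\<close> the classical
  derivative of \<open>h\<close>.\<close>

lemma sobolev_W2_imp_Ck_on: "sobolev_W2 b (Suc k) h \<Longrightarrow> Ck_on b k h"
proof (induction k arbitrary: h)
  case 0
  then obtain g where g: "\<And>x. x \<in> {0..b} \<Longrightarrow> (g has_integral (h x - h 0)) {0..x}"
    by fastforce
  show ?case
  proof (cases "0 \<le> b")
    case True
    then have "g integrable_on {0..b}" using g[of b] by (auto simp: integrable_on_def)
    then have "continuous_on {0..b} (\<lambda>x. h 0 + integral {0..x} g)"
      by (intro continuous_intros indefinite_integral_continuous_1)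
    moreover have "h x = h 0 + integral {0..x} g" if "x \<in> {0..b}" for x
      using integral_unique[OF g[OF that]] by simp
    ultimately show ?thesis
      using Ck_on_cong[of b 0 "\<lambda>x. h 0 + integral {0..x} g" h] unfolding Ck_on.simps(1) by blast
  qed simp
next
  case (Suc k)
  from Suc.prems obtain g where g: "sobolev_W2 b (Suc k) g"
      "\<And>x. x \<in> {0..b} \<Longrightarrow> (g has_integral (h x - h 0)) {0..x}"
    unfolding sobolev_W2.simps(2)[of b "Suc k"] by blast
  from Suc.IH[OF g(1)] have "Ck_on b k g" .
  moreover from this have "continuous_on {0..b} g" using Ck_on_mono[of b k g 0] by simp
  then have "deriv_on b (\<lambda>x. h 0 + integral {0..x} g) (\<lambda>x. 0 + g x)"
    by (intro deriv_on_add deriv_on_const deriv_on_integral)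
  then have "deriv_on b h g"
    by (rule deriv_on_cong) (use integral_unique[OF g(2)] in simp_all)
  ultimately show ?case by auto
qed

section \<open>The operator \<open>\<gamma>\<^sub>2\<gamma>\<^sub>1\<close>\<close>

lemma gamma21_deriv_on:
  assumes "0 < b" "deriv_on b g g'" "x \<in> {0..b}"
  shows "gamma21 b q g x = (1/2) * (g' x - g' 0 - integral {0..x} (\<lambda>s. q s * g s))"
  using assms deriv_on_vector_derivative[OF assms(1,2)] by (simp add: gamma21_def)

text \<open>The form in which \<open>\<gamma>\<^sub>2\<gamma>\<^sub>1\<close> is evaluated below: when \<open>g'' - q g\<close> is recognized as \<open>2 u'\<close>, both
  integrations are carried out by the fundamental theorem of calculus.\<close>

lemma gamma21_eq_increment:
  assumes b: "0 < b" and g: "deriv_on b g g'"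
    and g': "deriv_on b g' (\<lambda>x. q x * g x + 2 * u' x)" and u: "deriv_on b u u'"
    and x: "x \<in> {0..b}"
  shows "gamma21 b q g x = u x - u 0"
proof -
  have "((\<lambda>s. (q s * g s + 2 * u' s) - 2 * u' s) has_integral
      (g' x - g' 0) - 2 * (u x - u 0)) {0..x}"
    by (intro has_integral_diff has_integral_mult_right deriv_on_has_integral[OF g' x]
        deriv_on_has_integral[OF u x])
  then have "integral {0..x} (\<lambda>s. q s * g s) = (g' x - g' 0) - 2 * (u x - u 0)"
    by (simp add: integral_unique)
  then show ?thesis unfolding gamma21_deriv_on[OF b g x] by simp
qed

lemma gamma21_cong:
  assumes b: "0 < b" and eq: "\<And>y. y \<in> {0..b} \<Longrightarrow> g y = h y" and h: "C1_on b h"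
    and x: "x \<in> {0..b}"
  shows "gamma21 b q g x = gamma21 b q h x"
proof -
  obtain h' where h': "deriv_on b h h'" using C1_on_imp_deriv_on[OF h] by blast
  have "deriv_on b g h'" using deriv_on_cong[OF h' eq] by simp
  moreover have "integral {0..x} (\<lambda>s. q s * g s) = integral {0..x} (\<lambda>s. q s * h s)"
    using eq x by (intro integral_cong) auto
  ultimately show ?thesis
    by (simp add: gamma21_deriv_on[OF b _ x, of g h'] gamma21_deriv_on[OF b h' x])
qed

lemma integrable_on_potential:
  assumes "continuous_on {0..b} q" "deriv_on b g g'" "x \<in> {0..b}"
  shows "(\<lambda>s. q s * g s) integrable_on {0..x}"
proof (rule integrable_continuous_interval)
  have "continuous_on {0..b} (\<lambda>s. q s * g s)"
    using assms deriv_on_continuous by (blast intro: continuous_on_mult)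
  then show "continuous_on {0..x} (\<lambda>s. q s * g s)"
    by (rule continuous_on_subset) (use assms(3) in auto)
qed

lemma gamma21_diff:
  assumes b: "0 < b" and q: "continuous_on {0..b} q" and g: "C1_on b g"
    and h: "C1_on b h" and x: "x \<in> {0..b}"
  shows "gamma21 b q (\<lambda>x. g x - h x) x = gamma21 b q g x - gamma21 b q h x"
proof -
  obtain g' h' where g': "deriv_on b g g'" and h': "deriv_on b h h'"
    using C1_on_imp_deriv_on g h by blast
  show ?thesis
    unfolding gamma21_deriv_on[OF b deriv_on_diff[OF g' h'] x] gamma21_deriv_on[OF b g' x]
      gamma21_deriv_on[OF b h' x]
    using integral_diff[OF integrable_on_potential[OF q g' x] integrable_on_potential[OF q h' x]]
    by (simp add: right_diff_distrib diff_divide_distrib)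
qed

lemma gamma21_sum:
  assumes b: "0 < b" and q: "continuous_on {0..b} q" and I: "finite I"
    and C1: "\<And>i. i \<in> I \<Longrightarrow> C1_on b (g i)" and x: "x \<in> {0..b}"
  shows "gamma21 b q (\<lambda>x. \<Sum>i\<in>I. a i * g i x) x = (\<Sum>i\<in>I. a i * gamma21 b q (g i) x)"
proof -
  obtain g' where g: "\<And>i. i \<in> I \<Longrightarrow> deriv_on b (g i) (g' i)"
    using bchoice[of I "\<lambda>i g'. deriv_on b (g i) g'"] C1 C1_on_imp_deriv_on by blast
  have d: "deriv_on b (\<lambda>x. \<Sum>i\<in>I. a i * g i x) (\<lambda>x. \<Sum>i\<in>I. a i * g' i x)"
    by (intro deriv_on_sum deriv_on_cmult g)
  have "integral {0..x} (\<lambda>s. \<Sum>i\<in>I. a i * (q s * g i s))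
      = (\<Sum>i\<in>I. integral {0..x} (\<lambda>s. a i * (q s * g i s)))"
    using I integrable_on_potential[OF q g x]
    by (intro integral_sum) (auto intro: integrable_on_mult_right)
  then have int: "integral {0..x} (\<lambda>s. q s * (\<Sum>i\<in>I. a i * g i s))
      = (\<Sum>i\<in>I. a i * integral {0..x} (\<lambda>s. q s * g i s))"
    by (simp add: sum_distrib_left mult.left_commute)
  have "gamma21 b q (\<lambda>x. \<Sum>i\<in>I. a i * g i x) x
      = (\<Sum>i\<in>I. a i * ((1/2) * (g' i x - g' i 0 - integral {0..x} (\<lambda>s. q s * g i s))))"
    unfolding gamma21_deriv_on[OF b d x] int
    by (simp only: right_diff_distrib sum_subtractf sum_distrib_left mult.left_commute[of _ "1/2"])
  also have "\<dots> = (\<Sum>i\<in>I. a i * gamma21 b q (g i) x)"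
    using gamma21_deriv_on[OF b g x] by (intro sum.cong) simp_all
  finally show ?thesis .
qed

text \<open>The loss of one derivative comes from the term \<open>g'\<close>; the integral of \<open>q g\<close> is one
  derivative smoother than \<open>q\<close>, whence the bound \<open>k + 1\<close>.\<close>

lemma Ck_on_gamma21:
  assumes b: "0 < b" and q: "Ck_on b k q" and g: "Ck_on b (Suc m) g" and m: "m \<le> Suc k"
  shows "Ck_on b m (gamma21 b q g)"
proof -
  obtain g' where g': "Ck_on b m g'" "deriv_on b g g'" using g by auto
  have "continuous_on {0..b} (\<lambda>s. q s * g s)"
    using Ck_on_mono[OF q, of 0] deriv_on_continuous[OF g'(2)] by (auto intro: continuous_on_mult)
  then have int: "deriv_on b (\<lambda>x. integral {0..x} (\<lambda>s. q s * g s)) (\<lambda>x. q x * g x)"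
    by (rule deriv_on_integral)
  have "Ck_on b m (\<lambda>x. integral {0..x} (\<lambda>s. q s * g s))"
  proof (cases m)
    case 0
    then show ?thesis using deriv_on_continuous[OF int] by simp
  next
    case (Suc n)
    have "Ck_on b n (\<lambda>x. q x * g x)"
      using m Suc by (intro Ck_on_mult Ck_on_mono[OF q] Ck_on_mono[OF g]) auto
    with int Suc show ?thesis by auto
  qed
  then have "Ck_on b m (\<lambda>x. (1/2) * (g' x + (- g' 0 + (-1) * integral {0..x} (\<lambda>s. q s * g s))))"
    by (intro Ck_on_mult Ck_on_add Ck_on_const g'(1))
  then show ?thesis
    by (rule Ck_on_cong) (use gamma21_deriv_on[OF b g'(2)] in simp)
qed

lemma gamma21_pow_0: "gamma21_pow b q 0 g = g"
  by (simp add: gamma21_pow_def)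

lemma gamma21_pow_Suc: "gamma21_pow b q (Suc j) g = gamma21 b q (gamma21_pow b q j g)"
  by (simp add: gamma21_pow_def)

lemma Ck_on_gamma21_pow_one:
  assumes "0 < b" "Ck_on b k q" "i \<le> Suc (Suc k)"
  shows "Ck_on b (Suc (Suc k) - i) (gamma21_pow b q i (\<lambda>_. 1))"
  using assms(3)
proof (induction i)
  case 0
  show ?case unfolding gamma21_pow_0 by (rule Ck_on_const)
next
  case (Suc i)
  then have "Ck_on b (Suc (Suc k - i)) (gamma21_pow b q i (\<lambda>_. 1))"
    by (simp add: Suc_diff_le del: Ck_on.simps)
  then show ?case
    unfolding gamma21_pow_Suc using Ck_on_gamma21[OF assms(1,2)] by simp
qed

text \<open>Sobolev order \<open>i\<close> suffices for the \<open>i\<close>-th iterate because the constant \<open>1\<close> is smooth: its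
  first image inherits one derivative more than the \<open>i - 1\<close> classical derivatives of \<open>q\<close>, and the
  remaining \<open>i - 1\<close> steps consume one each.\<close>

lemma C1_on_gamma21_pow_one:
  assumes "0 < b" "sobolev_W2 b i q"
  shows "C1_on b (gamma21_pow b q i (\<lambda>_. 1))"
proof (cases i)
  case 0
  then show ?thesis unfolding gamma21_pow_0 C1_on_iff by (simp only: Ck_on_const gamma21_pow_0)
next
  case (Suc k)
  with assms(2) have "Ck_on b k q" using sobolev_W2_imp_Ck_on by blast
  from Ck_on_gamma21_pow_one[OF assms(1) this, of i] Suc show ?thesis by (simp add: C1_on_iff)
qed

section \<open>Convolution with divided powers of one parity\<close>

text \<open>Extending a sequence by zero to the index \<open>-1\<close> lets the recurrences that lower an index hold
  without exceptional small cases.\<close>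

definition shift :: "(nat \<Rightarrow> real \<Rightarrow> complex) \<Rightarrow> nat \<Rightarrow> real \<Rightarrow> complex" where
  "shift a n = (case n of 0 \<Rightarrow> \<lambda>_. 0 | Suc k \<Rightarrow> a k)"

lemma shift_0 [simp]: "shift a 0 = (\<lambda>_. 0)" and shift_Suc [simp]: "shift a (Suc n) = a n"
  by (simp_all add: shift_def)

lemma deriv_on_shift: "(\<And>n. deriv_on b (a n) (a' n)) \<Longrightarrow> deriv_on b (shift a n) (shift a' n)"
  by (cases n) (auto intro: deriv_on_const)

definition divided_power :: "nat \<Rightarrow> real \<Rightarrow> complex" where
  "divided_power k x = of_real x ^ k / fact k"

lemma deriv_on_divided_power: "deriv_on b (divided_power k) (shift divided_power k)"
proof (cases k)
  case 0
  moreover have "divided_power 0 = (\<lambda>_. 1)" by (simp add: divided_power_def fun_eq_iff)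
  ultimately show ?thesis using deriv_on_const[of b 1] by simp
next
  case (Suc n)
  have "((\<lambda>x. x ^ Suc n / fact (Suc n)) has_real_derivative x ^ n / fact n) (at x within {0..b})"
    for x :: real
    using DERIV_cdivide[OF DERIV_pow[of "Suc n" x "{0..b}"], of "fact (Suc n)"]
    by (simp add: field_simps del: of_nat_Suc power_Suc)
  then have "((\<lambda>x. of_real (x ^ Suc n / fact (Suc n)) :: complex)
      has_vector_derivative of_real (x ^ n / fact n)) (at x within {0..b})" for x
    by (rule has_vector_derivative_of_real)
  then show ?thesis
    unfolding Suc deriv_on_def divided_power_def shift_Suc of_real_divide of_real_power of_real_fact
    by blast
qed

text \<open>The coefficient of \<open>z\<^sup>m\<close> in the product of \<open>\<Sum>\<^sub>n a\<^sub>n z\<^sup>n\<close> with \<open>cosh (x z)\<close> for \<open>e = True\<close>, and with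
  \<open>sinh (x z)\<close> for \<open>e = False\<close>.  Treating both parities at once is useful since \<open>\<gamma>\<^sub>2\<gamma>\<^sub>1\<close> exchanges
  them.\<close>

definition parity_conv :: "bool \<Rightarrow> (nat \<Rightarrow> real \<Rightarrow> complex) \<Rightarrow> nat \<Rightarrow> real \<Rightarrow> complex" where
  "parity_conv e a m x = (\<Sum>k\<le>m. of_bool (even k = e) * (divided_power k x * a (m - k) x))"

lemma parity_conv_add:
  "parity_conv e (\<lambda>n x. a n x + c n x) m x = parity_conv e a m x + parity_conv e c m x"
  by (simp add: parity_conv_def algebra_simps sum.distrib)

lemma parity_conv_mult: "parity_conv e (\<lambda>n x. h x * a n x) m x = h x * parity_conv e a m x"
  by (simp add: parity_conv_def sum_distrib_left mult_ac)

lemma parity_conv_shift: "parity_conv e (shift a) m = shift (parity_conv e a) m"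
proof (cases m)
  case 0
  then show ?thesis by (simp add: parity_conv_def fun_eq_iff)
next
  case (Suc n)
  have "(\<Sum>k\<le>n. of_bool (even k = e) * (divided_power k x * shift a (Suc n - k) x))
      = (\<Sum>k\<le>n. of_bool (even k = e) * (divided_power k x * a (n - k) x))" for x
    by (intro sum.cong) (simp_all add: Suc_diff_le)
  then show ?thesis using Suc by (simp add: parity_conv_def fun_eq_iff del: sum_of_bool_mult_eq)
qed

lemma parity_conv_at_0: "parity_conv e a m 0 = of_bool e * a m 0"
proof -
  have "parity_conv e a m 0 = (\<Sum>k\<in>{0}. of_bool (even k = e) * (divided_power k 0 * a (m - k) 0))"
    unfolding parity_conv_def by (rule sum.mono_neutral_right) (auto simp: divided_power_def)
  then show ?thesis by (simp add: divided_power_def)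
qed

text \<open>Differentiating a divided power lowers its index by one and so flips the parity.\<close>

lemma deriv_on_parity_conv:
  assumes "\<And>n. deriv_on b (a n) (a' n)"
  shows "deriv_on b (parity_conv e a m)
    (\<lambda>x. parity_conv e a' m x + shift (parity_conv (\<not> e) a) m x)"
proof -
  have "shift (parity_conv (\<not> e) a) m x
      = (\<Sum>k\<le>m. of_bool (even k = e) * (shift divided_power k x * a (m - k) x))" for x
    by (cases m; cases e) (simp_all add: parity_conv_def sum.atMost_Suc_shift del: sum.atMost_Suc)
  then have "deriv_on b (\<lambda>x. \<Sum>k\<le>m. of_bool (even k = e) * (divided_power k x * a (m - k) x))
    (\<lambda>x. \<Sum>k\<le>m. of_bool (even k = e) *
        (divided_power k x * a' (m - k) x + shift divided_power k x * a (m - k) x))"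
    by (intro deriv_on_sum deriv_on_cmult deriv_on_mult deriv_on_divided_power assms)
  then show ?thesis
    by (rule deriv_on_cong)
      (simp_all add: parity_conv_def \<open>\<And>x. shift (parity_conv (\<not> e) a) m x = _\<close>
        ring_distribs sum.distrib)
qed


section \<open>Formal powers\<close>

lemma powi_alternating_sign: "(z::complex) powi ((- 1) ^ n) = (if even n then z else inverse z)"
  by (auto simp: power_int_minus)

text \<open>Normalized by the factorials, the family \<open>\<phi>\<^sub>k / f\<close> and its companion, in which the roles of \<open>X\<close>
  and its tilde variant are exchanged, differentiate into each other with the weights \<open>f\<^sup>-\<^sup>2\<close> and \<open>f\<^sup>2\<close> in
  every degree, so that no distinction of parities survives in the recurrences.\<close>

definition formal_power :: "(real \<Rightarrow> complex) \<Rightarrow> nat \<Rightarrow> real \<Rightarrow> complex" where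
  "formal_power f k x = (if odd k then X_fun f k x else X_tilde f k x) / fact k"

definition dual_formal_power :: "(real \<Rightarrow> complex) \<Rightarrow> nat \<Rightarrow> real \<Rightarrow> complex" where
  "dual_formal_power f k x = (if even k then X_fun f k x else X_tilde f k x) / fact k"

lemma formal_power_at_0: "formal_power f k 0 = of_bool (k = 0)"
  by (cases k) (simp_all add: formal_power_def)

lemma dual_formal_power_at_0: "dual_formal_power f k 0 = of_bool (k = 0)"
  by (cases k) (simp_all add: dual_formal_power_def)

locale schroedinger_solution =
  fixes b :: real and q f f' :: "real \<Rightarrow> complex"
  assumes b_pos: "0 < b"
    and q_continuous: "continuous_on {0..b} q"
    and deriv_f: "deriv_on b f f'"
    and deriv_f': "deriv_on b f' (\<lambda>x. q x * f x)"
    and f_at_0: "f 0 = 1"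
    and f_nonzero: "\<And>x. x \<in> {0..b} \<Longrightarrow> f x \<noteq> 0"
begin

lemma continuous_on_weight: "continuous_on {0..b} (\<lambda>x. (f x)\<^sup>2 powi ((- 1) ^ n))"
  unfolding powi_alternating_sign
  using deriv_on_continuous[OF deriv_f] f_nonzero
  by (cases "even n") (auto intro!: continuous_intros)

lemma deriv_on_X_fun:
  "deriv_on b (X_fun f (Suc n)) (\<lambda>x. of_nat (Suc n) * (X_fun f n x * (f x)\<^sup>2 powi ((- 1) ^ Suc n)))"
proof (induction n)
  case 0
  show ?case unfolding X_fun.simps
    by (intro deriv_on_cmult deriv_on_integral continuous_on_mult continuous_on_const
        continuous_on_weight)
next
  case (Suc n)
  show ?case unfolding X_fun.simps(2)[of f "Suc n"]
    by (intro deriv_on_cmult deriv_on_integral continuous_on_mult deriv_on_continuous[OF Suc]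
        continuous_on_weight)
qed

lemma deriv_on_X_tilde:
  "deriv_on b (X_tilde f (Suc n)) (\<lambda>x. of_nat (Suc n) * (X_tilde f n x * (f x)\<^sup>2 powi ((- 1) ^ n)))"
proof (induction n)
  case 0
  show ?case unfolding X_tilde.simps
    by (intro deriv_on_cmult deriv_on_integral continuous_on_mult continuous_on_const
        continuous_on_weight)
next
  case (Suc n)
  show ?case unfolding X_tilde.simps(2)[of f "Suc n"]
    by (intro deriv_on_cmult deriv_on_integral continuous_on_mult deriv_on_continuous[OF Suc]
        continuous_on_weight)
qed

lemma deriv_on_formal_power:
  "deriv_on b (formal_power f k) (\<lambda>x. shift (dual_formal_power f) k x / (f x)\<^sup>2)"
proof (cases k)
  case 0
  have "formal_power f 0 = (\<lambda>_. 1)" by (simp add: formal_power_def fun_eq_iff)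
  then show ?thesis using 0 deriv_on_const[of b 1] by simp
next
  case (Suc n)
  note d = deriv_on_cmult[OF deriv_on_X_fun, of "1 / fact (Suc n)" n]
    deriv_on_cmult[OF deriv_on_X_tilde, of "1 / fact (Suc n)" n]
  show ?thesis
  proof (cases "even n")
    case True
    with Suc show ?thesis
      by (intro deriv_on_cong[OF d(1)])
        (simp_all add: formal_power_def dual_formal_power_def powi_alternating_sign field_simps
          del: X_fun.simps power_Suc of_nat_Suc)
  next
    case False
    with Suc show ?thesis
      by (intro deriv_on_cong[OF d(2)])
        (simp_all add: formal_power_def dual_formal_power_def powi_alternating_sign field_simps
          del: X_tilde.simps power_Suc of_nat_Suc)
  qed
qed

lemma deriv_on_dual_formal_power:
  "deriv_on b (dual_formal_power f k) (\<lambda>x. shift (formal_power f) k x * (f x)\<^sup>2)"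
proof (cases k)
  case 0
  have "dual_formal_power f 0 = (\<lambda>_. 1)" by (simp add: dual_formal_power_def fun_eq_iff)
  then show ?thesis using 0 deriv_on_const[of b 1] by simp
next
  case (Suc n)
  note d = deriv_on_cmult[OF deriv_on_X_fun, of "1 / fact (Suc n)" n]
    deriv_on_cmult[OF deriv_on_X_tilde, of "1 / fact (Suc n)" n]
  show ?thesis
  proof (cases "even n")
    case True
    with Suc show ?thesis
      by (intro deriv_on_cong[OF d(2)])
        (simp_all add: formal_power_def dual_formal_power_def powi_alternating_sign field_simps
          del: X_tilde.simps power_Suc of_nat_Suc)
  next
    case False
    with Suc show ?thesis
      by (intro deriv_on_cong[OF d(1)])
        (simp_all add: formal_power_def dual_formal_power_def powi_alternating_sign field_simps
          del: X_fun.simps power_Suc of_nat_Suc)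
  qed
qed

definition scaled_phi :: "nat \<Rightarrow> real \<Rightarrow> complex" where
  "scaled_phi k x = f x * formal_power f k x"

definition scaled_phi_deriv :: "nat \<Rightarrow> real \<Rightarrow> complex" where
  "scaled_phi_deriv k x = f' x * formal_power f k x + shift (dual_formal_power f) k x * inverse (f x)"

lemma deriv_on_scaled_phi: "deriv_on b (scaled_phi k) (scaled_phi_deriv k)"
  by (rule deriv_on_cong[OF deriv_on_mult[OF deriv_f deriv_on_formal_power[of k]]])
    (simp_all add: scaled_phi_def scaled_phi_deriv_def f_nonzero field_simps power2_eq_square)

text \<open>The equation \<open>\<psi>\<^sub>k'' = q \<psi>\<^sub>k + \<psi>\<^sub>k\<^sub>-\<^sub>2\<close> for \<open>\<psi>\<^sub>k = \<phi>\<^sub>k / k!\<close>: the two terms with \<open>f' / f\<^sup>2\<close>, one from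
  differentiating \<open>\<phi>\<^sub>k / f\<close> and one from differentiating \<open>1 / f\<close>, cancel.\<close>

lemma deriv_on_scaled_phi_deriv:
  "deriv_on b (scaled_phi_deriv k) (\<lambda>x. q x * scaled_phi k x + shift (shift scaled_phi) k x)"
proof -
  have "shift (\<lambda>k x. shift (formal_power f) k x * (f x)\<^sup>2) k x * inverse (f x)
      = shift (shift scaled_phi) k x"
    if "x \<in> {0..b}" for x
    using f_nonzero[OF that]
    by (auto simp: shift_def scaled_phi_def power2_eq_square split: nat.split)
  moreover have "f' x * (shift (dual_formal_power f) k x / (f x)\<^sup>2)
      + shift (dual_formal_power f) k x * - (f' x / (f x)\<^sup>2) = 0" for x
    by simp
  ultimately have *: "q x * scaled_phi k x + shift (shift scaled_phi) k x
      = (f' x * (shift (dual_formal_power f) k x / (f x)\<^sup>2) + q x * f x * formal_power f k x)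
        + (shift (dual_formal_power f) k x * - (f' x / (f x)\<^sup>2)
        + shift (\<lambda>k x. shift (formal_power f) k x * (f x)\<^sup>2) k x * inverse (f x))"
    if "x \<in> {0..b}" for x
    using that by (simp add: scaled_phi_def algebra_simps)
  show ?thesis
    by (rule deriv_on_cong[OF deriv_on_add[OF deriv_on_mult[OF deriv_f' deriv_on_formal_power[of k]]
          deriv_on_mult[OF deriv_on_shift[OF deriv_on_dual_formal_power] deriv_on_inverse[OF deriv_f]]]])
      (simp_all only: scaled_phi_deriv_def f_nonzero * not_False_eq_True)
qed

text \<open>For \<open>e = True\<close> this is \<open>c\<^sub>m / m!\<close>; for \<open>e = False\<close> it is the analogous sum over odd \<open>k\<close>.\<close>

definition parity_c :: "bool \<Rightarrow> nat \<Rightarrow> real \<Rightarrow> complex" where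
  "parity_c e = parity_conv e scaled_phi"

definition parity_c_deriv :: "bool \<Rightarrow> nat \<Rightarrow> real \<Rightarrow> complex" where
  "parity_c_deriv e m x = parity_conv e scaled_phi_deriv m x + shift (parity_c (\<not> e)) m x"

lemma parity_c_at_0: "parity_c e m 0 = of_bool (e \<and> m = 0)"
  by (simp add: parity_c_def parity_conv_at_0 scaled_phi_def formal_power_at_0 f_at_0)

lemma deriv_on_parity_c: "deriv_on b (parity_c e m) (parity_c_deriv e m)"
  unfolding parity_c_def parity_c_deriv_def[abs_def] by (intro deriv_on_parity_conv deriv_on_scaled_phi)

text \<open>The product rule produces the index \<open>m - 2\<close> twice, from the second derivative of the divided
  powers and from \<open>\<psi>\<^sub>k\<^sub>-\<^sub>2\<close>, and the mixed terms also twice; half of them make up the derivative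
  of the opposite parity at \<open>m - 1\<close>.\<close>

lemma deriv_on_parity_c_deriv:
  "deriv_on b (parity_c_deriv e m)
    (\<lambda>x. q x * parity_c e m x + 2 * shift (parity_c_deriv (\<not> e)) m x)"
proof -
  have "shift (parity_c_deriv (\<not> e)) m x
      = shift (parity_conv (\<not> e) scaled_phi_deriv) m x + shift (shift (parity_c e)) m x" for x
    by (cases m) (simp_all add: parity_c_deriv_def)
  moreover have "parity_conv e (\<lambda>k x. q x * scaled_phi k x + shift (shift scaled_phi) k x) m x
      = q x * parity_c e m x + shift (shift (parity_c e)) m x" for x
    by (cases m) (simp_all add: parity_conv_add parity_conv_mult parity_conv_shift parity_c_def)
  ultimately have *: "q x * parity_c e m x + 2 * shift (parity_c_deriv (\<not> e)) m x
      = parity_conv e (\<lambda>k x. q x * scaled_phi k x + shift (shift scaled_phi) k x) m x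
        + shift (parity_conv (\<not> e) scaled_phi_deriv) m x + shift (parity_c_deriv (\<not> e)) m x" for x
    by simp
  show ?thesis
    by (rule deriv_on_cong[OF deriv_on_add[OF
            deriv_on_parity_conv[OF deriv_on_scaled_phi_deriv, where e = e and m = m]
            deriv_on_shift[OF deriv_on_parity_c, where n = m]]])
      (simp_all only: parity_c_deriv_def *)
qed

lemma C1_on_parity_c: "C1_on b (parity_c e m)"
  using deriv_on_parity_c deriv_on_parity_c_deriv by (rule C1_on_if_deriv_on)

text \<open>The subtracted constant is the value at \<open>0\<close> of the function of index \<open>m - 1\<close>, which vanishes
  unless that function is \<open>c\<^sub>0 = f\<close>.\<close>

lemma gamma21_parity_c:
  assumes "x \<in> {0..b}"
  shows "gamma21 b q (parity_c e m) x = shift (parity_c (\<not> e)) m x - of_bool (\<not> e \<and> m = 1)"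
proof -
  have "gamma21 b q (parity_c e m) x = shift (parity_c (\<not> e)) m x - shift (parity_c (\<not> e)) m 0"
    using b_pos deriv_on_parity_c deriv_on_parity_c_deriv deriv_on_shift[OF deriv_on_parity_c] assms
    by (rule gamma21_eq_increment)
  also have "shift (parity_c (\<not> e)) m 0 = of_bool (\<not> e \<and> m = 1)"
    by (cases m) (simp_all add: parity_c_at_0)
  finally show ?thesis .
qed

text \<open>For even \<open>k\<close> the only contribution at \<open>0\<close> is that of \<open>\<psi>\<^sub>m / f\<close> (\<open>k = 0\<close>), for odd \<open>k\<close> that of
  \<open>x \<psi>\<^sub>m\<^sub>-\<^sub>1 / f\<close> (\<open>k = 1\<close>); both have derivative \<open>1\<close> at \<open>0\<close> exactly when \<open>m = 1\<close>.\<close>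

lemma parity_c_quotient_derivative_at_0:
  "((\<lambda>x. parity_c e m x / f x) has_vector_derivative of_bool (m = 1)) (at 0 within {0..b})"
proof -
  have "deriv_on b (\<lambda>x. parity_c e m x / f x)
      (\<lambda>x. parity_conv e (\<lambda>k x. shift (dual_formal_power f) k x / (f x)\<^sup>2) m x
      + shift (parity_conv (\<not> e) (formal_power f)) m x)"
    by (rule deriv_on_cong[OF deriv_on_parity_conv[OF deriv_on_formal_power]])
      (simp_all add: parity_c_def scaled_phi_def[abs_def] parity_conv_mult f_nonzero)
  moreover have "0 \<in> {0..b}" using b_pos by simp
  moreover have "parity_conv e (\<lambda>k x. shift (dual_formal_power f) k x / (f x)\<^sup>2) m 0
      + shift (parity_conv (\<not> e) (formal_power f)) m 0 = of_bool (m = 1)"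
    by (cases m) (auto simp: parity_conv_at_0 f_at_0 formal_power_at_0 dual_formal_power_at_0)
  ultimately show ?thesis using deriv_onD by fastforce
qed

lemma c_poly_eq_parity_c: "c_poly f N \<alpha> x = (\<Sum>n\<le>N. \<alpha> n * parity_c True n x)"
proof -
  have "c_fun f m x / fact m = parity_c True m x" for m
  proof -
    have "c_fun f m x
        = (\<Sum>k\<le>m. of_bool (even k) * (of_nat (m choose k) * of_real x ^ k * phi f (m - k) x))"
      unfolding c_fun_def by (rule sum.mono_neutral_cong_left) auto
    also have "\<dots> / fact m = parity_c True m x"
      unfolding parity_c_def parity_conv_def sum_divide_distrib
      by (intro sum.cong) (auto simp: binomial_fact scaled_phi_def phi_def formal_power_def divided_power_def)
    finally show ?thesis .
  qed
  then show ?thesis by (simp add: c_poly_def)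
qed

section \<open>Iterates of a \<open>c\<close>-polynomial\<close>

text \<open>The \<open>j\<close>-th iterate on a \<open>c\<close>-polynomial is the difference of two parts: the terms whose index has
  come down by \<open>j\<close> and is still non-negative, and the iterates of the constants ejected on the way.\<close>

definition descended_part :: "nat \<Rightarrow> (nat \<Rightarrow> complex) \<Rightarrow> nat \<Rightarrow> real \<Rightarrow> complex" where
  "descended_part N \<alpha> j x = (\<Sum>n\<le>N - j. \<alpha> (n + j) * parity_c (even j) n x)"

definition spawned_part :: "(nat \<Rightarrow> complex) \<Rightarrow> nat \<Rightarrow> real \<Rightarrow> complex" where
  "spawned_part \<alpha> j x = (\<Sum>n | 2 \<le> n \<and> n \<le> j \<and> even n. \<alpha> n * gamma21_pow b q (j - n) (\<lambda>_. 1) x)"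

lemma finite_spawning_indices: "finite {n::nat. 2 \<le> n \<and> n \<le> j \<and> even n}"
  by (rule finite_subset[of _ "{..j}"]) auto

lemma C1_on_descended_part: "C1_on b (descended_part N \<alpha> j)"
  unfolding descended_part_def[abs_def] by (intro C1_on_sum C1_on_cmult C1_on_parity_c finite_atMost)

text \<open>The subtracted constant is what the term of index \<open>1\<close> ejects.  This occurs only for odd \<open>j\<close>;
  by lemma \<open>gamma21_spawned_part\<close> below the other part then gains the same constant.\<close>

lemma gamma21_descended_part:
  assumes "j < N" "x \<in> {0..b}"
  shows "gamma21 b q (descended_part N \<alpha> j) x = descended_part N \<alpha> (Suc j) x - of_bool (odd j) * \<alpha> (Suc j)"
proof -
  obtain M where M: "N - j = Suc M" "N - Suc j = M"
    using assms(1) by (metis Suc_diff_Suc)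
  have delta: "(\<Sum>n\<le>M. \<alpha> (Suc (n + j)) * of_bool (odd j \<and> n = 0)) = of_bool (odd j) * \<alpha> (Suc j)"
    by (cases "odd j") (simp_all add: of_bool_def if_distrib cong: if_cong)
  have "gamma21 b q (descended_part N \<alpha> j) x
      = (\<Sum>n\<le>Suc M. \<alpha> (n + j) * gamma21 b q (parity_c (even j) n) x)"
    unfolding descended_part_def[abs_def] M
    using gamma21_sum[OF b_pos q_continuous finite_atMost C1_on_parity_c assms(2)] .
  also have "\<dots> = (\<Sum>n\<le>M. \<alpha> (Suc (n + j)) * (parity_c (odd j) n x - of_bool (odd j \<and> n = 0)))"
    by (simp add: gamma21_parity_c[OF assms(2)] sum.atMost_Suc_shift del: sum.atMost_Suc)
  also have "\<dots> = descended_part N \<alpha> (Suc j) x - of_bool (odd j) * \<alpha> (Suc j)"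
    unfolding right_diff_distrib sum_subtractf delta by (simp add: descended_part_def M)
  finally show ?thesis .
qed

lemma C1_on_spawned_part:
  assumes "\<And>n. 2 \<le> n \<Longrightarrow> n \<le> j \<Longrightarrow> even n \<Longrightarrow> C1_on b (gamma21_pow b q (j - n) (\<lambda>_. 1))"
  shows "C1_on b (spawned_part \<alpha> j)"
  unfolding spawned_part_def[abs_def] by (intro C1_on_sum C1_on_cmult finite_spawning_indices)
    (use assms in auto)

text \<open>For odd \<open>j\<close> the sum at \<open>j + 1\<close> has the new term \<open>\<alpha>\<^sub>j\<^sub>+\<^sub>1\<close>, where the iterate of order zero on the
  constant \<open>1\<close> appears for the first time; it is subtracted again on the right.\<close>

lemma gamma21_spawned_part:
  assumes "\<And>n. 2 \<le> n \<Longrightarrow> n \<le> j \<Longrightarrow> even n \<Longrightarrow> C1_on b (gamma21_pow b q (j - n) (\<lambda>_. 1))"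
    and "x \<in> {0..b}"
  shows "gamma21 b q (spawned_part \<alpha> j) x = spawned_part \<alpha> (Suc j) x - of_bool (odd j) * \<alpha> (Suc j)"
proof -
  let ?I = "\<lambda>j. {n::nat. 2 \<le> n \<and> n \<le> j \<and> even n}"
  have "gamma21 b q (spawned_part \<alpha> j) x
      = (\<Sum>n\<in>?I j. \<alpha> n * gamma21 b q (gamma21_pow b q (j - n) (\<lambda>_. 1)) x)"
    unfolding spawned_part_def[abs_def]
    by (rule gamma21_sum[OF b_pos q_continuous finite_spawning_indices _ assms(2)]) (use assms(1) in auto)
  also have "\<dots> = (\<Sum>n\<in>?I j. \<alpha> n * gamma21_pow b q (Suc j - n) (\<lambda>_. 1) x)"
    by (intro sum.cong) (auto simp: Suc_diff_le gamma21_pow_Suc)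
  also have "\<dots> = spawned_part \<alpha> (Suc j) x - of_bool (odd j) * \<alpha> (Suc j)"
  proof (cases "odd j")
    case True
    then have "?I (Suc j) = insert (Suc j) (?I j)" by (auto simp: le_Suc_eq elim!: oddE)
    then show ?thesis using True finite_spawning_indices by (simp add: spawned_part_def gamma21_pow_0)
  next
    case False
    then have "?I (Suc j) = ?I j" by (auto simp: le_Suc_eq)
    then show ?thesis using False by (simp add: spawned_part_def)
  qed
  finally show ?thesis .
qed

lemma gamma1_at_0:
  assumes "((\<lambda>s. g s / f s) has_vector_derivative d) (at 0 within {0..b})"
  shows "gamma1_exists_at b f g 0" "gamma1 b f g 0 = d"
proof -
  show "gamma1_exists_at b f g 0"
    using assms unfolding gamma1_exists_at_def by (rule differentiableI_vector)
  have "vector_derivative (\<lambda>s. g s / f s) (at 0 within {0..b}) = d"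
    using vector_derivative_within_closed_interval[OF b_pos _ assms] b_pos by simp
  then show "gamma1 b f g 0 = d" by (simp add: gamma1_def f_at_0)
qed

lemma gamma1_at_0_has_derivative:
  assumes "gamma1_exists_at b f g 0"
  shows "((\<lambda>s. g s / f s) has_vector_derivative gamma1 b f g 0) (at 0 within {0..b})"
  using assms by (simp add: gamma1_exists_at_def gamma1_def f_at_0 vector_derivative_works)

context
  fixes N :: nat
  assumes regular: "\<And>j n. j < N \<Longrightarrow> 2 \<le> n \<Longrightarrow> n \<le> j \<Longrightarrow> even n \<Longrightarrow> regular_for b q f (j - n)"
begin

text \<open>The step from \<open>j\<close> to \<open>j + 1\<close> applies the operator to the \<open>(j - n)\<close>-th iterate on \<open>1\<close>; the
  regularity required of \<open>q\<close> is the one attached to the occurrence of the next iterate in the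
  relation for \<open>j + 1\<close>, hence the bound \<open>j + 1 < N\<close>.\<close>

lemma C1_on_iterates_of_one:
  assumes "Suc j < N" "2 \<le> n" "n \<le> j" "even n"
  shows "C1_on b (gamma21_pow b q (j - n) (\<lambda>_. 1))"
proof (rule C1_on_gamma21_pow_one[OF b_pos])
  show "sobolev_W2 b (j - n) q"
    using regular[OF assms(1,2) _ assms(4)] assms(3) by (simp add: regular_for_def Suc_diff_le)
qed

context
  fixes C \<alpha>
  assumes C_eq: "\<And>x. x \<in> {0..b} \<Longrightarrow> C x = c_poly f N \<alpha> x"
begin

lemma gamma21_pow_c_poly:
  assumes "j < N" "x \<in> {0..b}"
  shows "gamma21_pow b q j C x = descended_part N \<alpha> j x - spawned_part \<alpha> j x"
  using assms
proof (induction j arbitrary: x)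
  case 0
  then show ?case by (simp add: gamma21_pow_0 C_eq c_poly_eq_parity_c descended_part_def
        spawned_part_def cong: conj_cong)
next
  case (Suc j)
  have C1_spawned: "C1_on b (spawned_part \<alpha> j)"
    by (intro C1_on_spawned_part C1_on_iterates_of_one Suc.prems)
  have "gamma21_pow b q (Suc j) C x = gamma21 b q (\<lambda>x. descended_part N \<alpha> j x - spawned_part \<alpha> j x) x"
    unfolding gamma21_pow_Suc
    using Suc by (intro gamma21_cong[OF b_pos] C1_on_diff C1_on_descended_part C1_spawned) auto
  also have "\<dots> = gamma21 b q (descended_part N \<alpha> j) x - gamma21 b q (spawned_part \<alpha> j) x"
    by (intro gamma21_diff b_pos q_continuous C1_on_descended_part C1_spawned Suc.prems)
  also have "\<dots> = descended_part N \<alpha> (Suc j) x - spawned_part \<alpha> (Suc j) x"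
    using gamma21_descended_part[of j N x \<alpha>]
      gamma21_spawned_part[OF C1_on_iterates_of_one[OF Suc.prems(1)]]
      Suc.prems
    by simp
  finally show ?case .
qed

lemma gamma21_pow_c_poly_defined: "j < N \<Longrightarrow> gamma21_pow_defined b q j C"
  unfolding gamma21_pow_defined_def
proof (intro allI impI)
  fix i assume "j < N" "i < j"
  then have "Suc i < N" by simp
  then have "C1_on b (\<lambda>x. descended_part N \<alpha> i x - spawned_part \<alpha> i x)"
    by (intro C1_on_diff C1_on_descended_part C1_on_spawned_part C1_on_iterates_of_one)
  then show "C1_on b (gamma21_pow b q i C)"
    by (rule C1_on_cong) (use gamma21_pow_c_poly \<open>Suc i < N\<close> in simp)
qed

lemma gamma1_gamma21_pow_c_poly_derivative:
  assumes j: "j < N"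
  shows "((\<lambda>s. gamma21_pow b q j C s / f s) has_vector_derivative
    \<alpha> (j + 1) - (\<Sum>n | 2 \<le> n \<and> n \<le> j \<and> even n.
       \<alpha> n * gamma1 b f (gamma21_pow b q (j - n) (\<lambda>_. 1)) 0)) (at 0 within {0..b})"
proof -
  let ?I = "{n. 2 \<le> n \<and> n \<le> j \<and> even n}"
  have d: "((\<lambda>s. (\<Sum>n\<le>N - j. \<alpha> (n + j) * (parity_c (even j) n s / f s))
        - (\<Sum>n\<in>?I. \<alpha> n * (gamma21_pow b q (j - n) (\<lambda>_. 1) s / f s)))
      has_vector_derivative (\<Sum>n\<le>N - j. \<alpha> (n + j) * of_bool (n = 1))
        - (\<Sum>n\<in>?I. \<alpha> n * gamma1 b f (gamma21_pow b q (j - n) (\<lambda>_. 1)) 0)) (at 0 within {0..b})"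
    using regular[OF j]
    by (intro has_vector_derivative_diff has_vector_derivative_sum has_vector_derivative_mult_right
        parity_c_quotient_derivative_at_0 gamma1_at_0_has_derivative) (auto simp: regular_for_def)
  have s: "(\<Sum>n\<le>N - j. \<alpha> (n + j) * of_bool (n = 1)) = \<alpha> (j + 1)"
    using j by (simp add: of_bool_def if_distrib cong: if_cong)
  have eq: "gamma21_pow b q j C s / f s = (\<Sum>n\<le>N - j. \<alpha> (n + j) * (parity_c (even j) n s / f s))
        - (\<Sum>n\<in>?I. \<alpha> n * (gamma21_pow b q (j - n) (\<lambda>_. 1) s / f s))" if "s \<in> {0..b}" for s
    by (simp add: gamma21_pow_c_poly[OF j that] descended_part_def spawned_part_def
        diff_divide_distrib sum_divide_distrib)
  have "0 \<in> {0..b}" using b_pos by simp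
  from has_vector_derivative_transform[OF this eq d] show ?thesis unfolding s .
qed

lemma c_poly_coeff_relations: "coeff_relations b q f C N \<alpha>"
proof -
  have "C 0 = \<alpha> 0"
  proof -
    have "C 0 = (\<Sum>n\<le>N. \<alpha> n * of_bool (n = 0))"
      using C_eq[of 0] b_pos by (simp add: c_poly_eq_parity_c parity_c_at_0)
    then show ?thesis by (simp add: of_bool_def if_distrib cong: if_cong)
  qed
  then show ?thesis
    unfolding coeff_relations_def using gamma1_at_0(2)[OF gamma1_gamma21_pow_c_poly_derivative]
    by simp
qed

end

end

end

text \<open>The right-hand side for \<open>j\<close> involves only coefficients of index at most \<open>j\<close>.\<close>

lemma coeff_relations_unique:
  assumes "coeff_relations b q f C N \<alpha>" "coeff_relations b q f C N \<beta>" "n \<le> N"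
  shows "\<beta> n = \<alpha> n"
  using assms(3)
proof (induction n rule: less_induct)
  case (less n)
  show ?case
  proof (cases n)
    case 0
    then show ?thesis using assms by (simp add: coeff_relations_def)
  next
    case (Suc j)
    have "(\<Sum>n | 2 \<le> n \<and> n \<le> j \<and> even n. \<beta> n * gamma1 b f (gamma21_pow b q (j - n) (\<lambda>_. 1)) 0)
        = (\<Sum>n | 2 \<le> n \<and> n \<le> j \<and> even n. \<alpha> n * gamma1 b f (gamma21_pow b q (j - n) (\<lambda>_. 1)) 0)"
      using less Suc by (intro sum.cong) auto
    then show ?thesis using assms(1,2) less.prems Suc by (simp add: coeff_relations_def)
  qed
qed

theorem proposition4p5:
  fixes b :: real and q f C :: "real \<Rightarrow> complex" and N :: nat and \<alpha> :: "nat \<Rightarrow> complex"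
  assumes "0 < b"
    and "continuous_on {0..b} q"
    and "solves_schroedinger b q f"
    and "f 0 = 1"
    and "\<forall>x\<in>{0..b}. f x \<noteq> 0"
    and "\<forall>j<N. \<forall>n. 2 \<le> n \<and> n \<le> j \<and> even n \<longrightarrow> regular_for b q f (j - n)"
    and "\<forall>x\<in>{0..b}. C x = c_poly f N \<alpha> x"
  shows "(\<forall>j<N. gamma21_pow_defined b q j C \<and> gamma1_exists_at b f (gamma21_pow b q j C) 0)
    \<and> coeff_relations b q f C N \<alpha>
    \<and> (\<forall>\<beta>. coeff_relations b q f C N \<beta> \<longrightarrow> (\<forall>n\<le>N. \<beta> n = \<alpha> n))
    \<and> (\<forall>\<beta>. (\<forall>x\<in>{0..b}. C x = c_poly f N \<beta> x) \<longrightarrow> (\<forall>n\<le>N. \<beta> n = \<alpha> n))"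
proof -
  obtain f' where "deriv_on b f f'" "deriv_on b f' (\<lambda>x. q x * f x)"
    using assms(3) unfolding solves_schroedinger_def deriv_on_def by blast
  then interpret schroedinger_solution b q f f'
    by unfold_locales (use assms in auto)
  have regular: "regular_for b q f (j - n)" if "j < N" "2 \<le> n" "n \<le> j" "even n" for j n
    using assms(6) that by blast
  have rel: "coeff_relations b q f C N \<beta>" if "\<forall>x\<in>{0..b}. C x = c_poly f N \<beta> x" for \<beta>
    using c_poly_coeff_relations[OF regular] that by blast
  have "gamma21_pow_defined b q j C \<and> gamma1_exists_at b f (gamma21_pow b q j C) 0" if "j < N" for j
    using gamma21_pow_c_poly_defined[OF regular _ that, of C \<alpha>]
      gamma1_at_0(1)[OF gamma1_gamma21_pow_c_poly_derivative[OF regular _ that, of C \<alpha>]] assms(7)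
    by blast
  moreover have "coeff_relations b q f C N \<alpha>" using rel assms(7) by blast
  ultimately show ?thesis using rel coeff_relations_unique by blast
qed

end
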